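(* Let $(\Phi,M)$ and $(\Psi,N)$ be incarnations of data sets and let $\Omega$ be a basis of $(\Phi,M)$. Then two SEOs $(\alpha,T),(\alpha',T')\colon(\Phi,M)\to(\Psi,N)$ are equal if and only if $T=T'$ and $\alpha(\omega)=\alpha'(\omega)$ for every $\omega$ in $\Omega$.
   Context: A data set is a finite set $\Phi=\{\phi_i\colon X\to\mathbf{R}\mid i=1,\dots,m\}$ of real-valued functions (measurements) on a finite set $X$. $\mathrm{End}_\Phi(X)$ is the monoid of functions $g\colon X\to X$ such that $\phi g:=\phi\circ g\in\Phi$ for every $\phi\in\Phi$. An incarnation of $\Phi$ is a pair $(\Phi,M)$ with $M\subset\mathrm{End}_\Phi(X)$ a subset. A SEO (set equivariant operator) $(\alpha,T)\colon(\Phi,M)\to(\Psi,N)$ between incarnations is a pair of functions $\alpha\colon\Phi\to\Psi$ and $T\colon M\to N$ with $\alpha(\phi g)=\alpha(\phi)T(g)$ for all $\phi\in\Phi$, $g\in M$. For $\Omega\subset\Phi$, $\Omega M$ denotes the set of all measurements in $\Phi$ which either belong to $\Omega$ or are of the form $\omega g_1\cdots g_k$ for some $\omega\in\Omega$ and $g_1,\dots,g_k\in M$. Write $\phi M:=\{\phi\}M$. A subset $\Omega\subset\Phi$ is independent if $\omega\notin\omega'M$ for all $\omega\neq\omega'$ in $\Omega$. A basis of $(\Phi,M)$ is an independent subset $\Omega\subset\Phi$ with $\Omega M=\Phi$. *)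

theory Defs
  imports Complex_Main "HOL-Library.FuncSet"
begin

(* Functions between carrier sets are extensional (elements of A \<rightarrow>\<^sub>E B), so that HOL
   equality is equality of functions on the given domain. Accordingly \<phi>g is compose X \<phi> g,
   the composite \<phi> \<circ> g restricted to X. *)

definition data_set :: "'a set \<Rightarrow> ('a \<Rightarrow> real) set \<Rightarrow> bool" where
  "data_set X \<Phi> \<longleftrightarrow> finite X \<and> finite \<Phi> \<and> \<Phi> \<subseteq> X \<rightarrow>\<^sub>E (UNIV :: real set)"

definition End_data :: "'a set \<Rightarrow> ('a \<Rightarrow> real) set \<Rightarrow> ('a \<Rightarrow> 'a) set" where
  "End_data X \<Phi> = {g \<in> X \<rightarrow>\<^sub>E X. \<forall>\<phi>\<in>\<Phi>. compose X \<phi> g \<in> \<Phi>}"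

definition incarnation :: "'a set \<Rightarrow> ('a \<Rightarrow> real) set \<Rightarrow> ('a \<Rightarrow> 'a) set \<Rightarrow> bool" where
  "incarnation X \<Phi> M \<longleftrightarrow> data_set X \<Phi> \<and> M \<subseteq> End_data X \<Phi>"

definition SEO ::
  "'a set \<Rightarrow> ('a \<Rightarrow> real) set \<Rightarrow> ('a \<Rightarrow> 'a) set \<Rightarrow>
   'b set \<Rightarrow> ('b \<Rightarrow> real) set \<Rightarrow> ('b \<Rightarrow> 'b) set \<Rightarrow>
   ((('a \<Rightarrow> real) \<Rightarrow> ('b \<Rightarrow> real)) \<times> (('a \<Rightarrow> 'a) \<Rightarrow> ('b \<Rightarrow> 'b))) set" where
  "SEO X \<Phi> M Y \<Psi> N =
     {(\<alpha>, T). \<alpha> \<in> \<Phi> \<rightarrow>\<^sub>E \<Psi> \<and> T \<in> M \<rightarrow>\<^sub>E N \<and>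
        (\<forall>\<phi>\<in>\<Phi>. \<forall>g\<in>M. \<alpha> (compose X \<phi> g) = compose Y (\<alpha> \<phi>) (T g))}"

(* The set \<Omega>M: the left fold of [g1, ..., gk] starting at \<omega> is \<omega> g1 ... gk. *)
definition generated ::
  "'a set \<Rightarrow> ('a \<Rightarrow> real) set \<Rightarrow> ('a \<Rightarrow> 'a) set \<Rightarrow> ('a \<Rightarrow> real) set \<Rightarrow> ('a \<Rightarrow> real) set" where
  "generated X \<Phi> M \<Omega> =
     {\<phi> \<in> \<Phi>. \<phi> \<in> \<Omega> \<or>
        (\<exists>\<omega>\<in>\<Omega>. \<exists>gs. gs \<noteq> [] \<and> set gs \<subseteq> M \<and> \<phi> = foldl (compose X) \<omega> gs)}"

definition independent_in ::
  "'a set \<Rightarrow> ('a \<Rightarrow> real) set \<Rightarrow> ('a \<Rightarrow> 'a) set \<Rightarrow> ('a \<Rightarrow> real) set \<Rightarrow> bool" where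
  "independent_in X \<Phi> M \<Omega> \<longleftrightarrow>
     \<Omega> \<subseteq> \<Phi> \<and> (\<forall>\<omega>\<in>\<Omega>. \<forall>\<omega>'\<in>\<Omega>. \<omega> \<noteq> \<omega>' \<longrightarrow> \<omega> \<notin> generated X \<Phi> M {\<omega>'})"

definition basis_of ::
  "'a set \<Rightarrow> ('a \<Rightarrow> real) set \<Rightarrow> ('a \<Rightarrow> 'a) set \<Rightarrow> ('a \<Rightarrow> real) set \<Rightarrow> bool" where
  "basis_of X \<Phi> M \<Omega> \<longleftrightarrow> independent_in X \<Phi> M \<Omega> \<and> generated X \<Phi> M \<Omega> = \<Phi>"

end

theory Submission
  imports Defs
begin

text \<open>Equivariance passes from single elements of \<open>M\<close> to words: a SEO sends
  \<omega> g1 ... gk to \<alpha>(\<omega>) T(g1) ... T(gk), which is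
  \<open>SEO_foldl_compose\<close>. Since a basis generates, every measurement in \<Phi> is such a
  word applied to some \<omega> in \<Omega>, so its image is determined by \<open>T\<close> and
  \<alpha>(\<omega>); this is \<open>SEO_eq_on_generated\<close>. The forward implication is
  immediate.\<close>

lemma SEO_compose:
  assumes "(\<alpha>, T) \<in> SEO X \<Phi> M Y \<Psi> N" "\<phi> \<in> \<Phi>" "g \<in> M"
  shows "\<alpha> (compose X \<phi> g) = compose Y (\<alpha> \<phi>) (T g)"
  using assms by (simp add: SEO_def)

lemma SEO_foldl_compose:
  assumes "M \<subseteq> End_data X \<Phi>" "(\<alpha>, T) \<in> SEO X \<Phi> M Y \<Psi> N" "\<phi> \<in> \<Phi>" "set gs \<subseteq> M"
  shows "\<alpha> (foldl (compose X) \<phi> gs) = foldl (compose Y) (\<alpha> \<phi>) (map T gs)"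
  using assms(3,4)
proof (induction gs arbitrary: \<phi>)
  case Nil
  then show ?case by simp
next
  case (Cons g gs)
  \<comment> \<open>Equivariance is available only at measurements in \<Phi>; closure of \<Phi>
    under \<open>M\<close> lets the induction hypothesis apply to \<phi>g.\<close>
  then have "compose X \<phi> g \<in> \<Phi>"
    using assms(1) by (auto simp: End_data_def)
  then show ?case
    using Cons SEO_compose[OF assms(2)] by simp
qed

text \<open>With a common \<open>T\<close>, both maps send \<omega> g1 ... gk to the same word T(g1)
  ... T(gk) applied to the same measurement \<alpha>(\<omega>) = \<alpha>'(\<omega>).\<close>

lemma SEO_eq_on_generated:
  assumes "M \<subseteq> End_data X \<Phi>" "\<Omega> \<subseteq> \<Phi>"
    and "(\<alpha>, T) \<in> SEO X \<Phi> M Y \<Psi> N" "(\<alpha>', T) \<in> SEO X \<Phi> M Y \<Psi> N"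
    and "\<forall>\<omega>\<in>\<Omega>. \<alpha> \<omega> = \<alpha>' \<omega>" "\<phi> \<in> generated X \<Phi> M \<Omega>"
  shows "\<alpha> \<phi> = \<alpha>' \<phi>"
proof -
  \<comment> \<open>Allowing the empty word merges the two clauses of \<open>generated\<close> into
    one.\<close>
  obtain \<omega> gs where \<omega>: "\<omega> \<in> \<Omega>" and gs: "set gs \<subseteq> M" and \<phi>: "\<phi> = foldl (compose X) \<omega> gs"
  proof (cases "\<phi> \<in> \<Omega>")
    case True
    then show ?thesis using that[of \<phi> "[]"] by simp
  next
    case False
    then show ?thesis using assms(6) that by (auto simp: generated_def)
  qed
  have "\<omega> \<in> \<Phi>" using \<omega> assms(2) by blast
  then show ?thesis
    using SEO_foldl_compose[OF assms(1,3) _ gs] SEO_foldl_compose[OF assms(1,4) _ gs] assms(5) \<omega> \<phi>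
    by simp
qed

theorem proposition4:
  fixes X :: "'a set" and \<Phi> :: "('a \<Rightarrow> real) set" and M :: "('a \<Rightarrow> 'a) set"
    and Y :: "'b set" and \<Psi> :: "('b \<Rightarrow> real) set" and N :: "('b \<Rightarrow> 'b) set"
    and \<Omega> :: "('a \<Rightarrow> real) set"
    and \<alpha> \<alpha>' :: "('a \<Rightarrow> real) \<Rightarrow> ('b \<Rightarrow> real)"
    and T T' :: "('a \<Rightarrow> 'a) \<Rightarrow> ('b \<Rightarrow> 'b)"
  assumes "incarnation X \<Phi> M"
    and "incarnation Y \<Psi> N"
    and "basis_of X \<Phi> M \<Omega>"
    and "(\<alpha>, T) \<in> SEO X \<Phi> M Y \<Psi> N"
    and "(\<alpha>', T') \<in> SEO X \<Phi> M Y \<Psi> N"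
  shows "(\<alpha>, T) = (\<alpha>', T') \<longleftrightarrow> T = T' \<and> (\<forall>\<omega>\<in>\<Omega>. \<alpha> \<omega> = \<alpha>' \<omega>)"
proof (intro iffI conjI)
  assume R: "T = T' \<and> (\<forall>\<omega>\<in>\<Omega>. \<alpha> \<omega> = \<alpha>' \<omega>)"
  have M: "M \<subseteq> End_data X \<Phi>" and \<Omega>: "\<Omega> \<subseteq> \<Phi>" and gen: "generated X \<Phi> M \<Omega> = \<Phi>"
    using assms(1,3) by (auto simp: incarnation_def basis_of_def independent_in_def)
  \<comment> \<open>Both maps are extensional on \<Phi>, so agreement on \<Phi> gives equality as
    HOL functions.\<close>
  have "\<alpha> \<in> \<Phi> \<rightarrow>\<^sub>E \<Psi>" "\<alpha>' \<in> \<Phi> \<rightarrow>\<^sub>E \<Psi>"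
    using assms(4,5) by (auto simp: SEO_def)
  moreover have "\<alpha> \<phi> = \<alpha>' \<phi>" if "\<phi> \<in> \<Phi>" for \<phi>
    using SEO_eq_on_generated[OF M \<Omega>] assms(4,5) R gen that by blast
  ultimately have "\<alpha> = \<alpha>'" by (rule PiE_ext)
  with R show "(\<alpha>, T) = (\<alpha>', T')" by simp
qed auto

end
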